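(* Consider applying the regularized Gauss-Seidel algorithm (described in the context) to the DSPI problem under continuous interdiction in which all agents have a common source-target pair $(s,t)$ and each agent $f\in\mathcal F$, given $x^{-f}$, solves $$\max_{x^f}\ \theta^f(x^f,x^{-f})=\min_{p\in P^{st}}\sum_{(u,v)\in p}\Big(d^0_{uv}+\sum_{g\in\mathcal F}x^g_{uv}\Big)\quad\text{s.t.}\quad\sum_{(u,v)\in A}c^f_{uv}x^f_{uv}\le b^f,\quad x^f\ge0 .$$ Let $\{\chi_k\}$ be the sequence generated by the algorithm. If $\bar\chi$ is a cluster point of this sequence, then $\bar\chi$ solves the DSPI problem, i.e. it is a pure strategy Nash equilibrium of the game.
   Context: $G=(V,A)$ is a finite directed network; $\mathcal F=\{1,\dots,F\}$ is the set of agents; $P^{st}$ is the nonempty set of directed $s$-$t$ paths; agent $f$ has budget $b^f>0$ and costs $c^f_{uv}>0$; $d^0_{uv}>0$ are initial arc lengths. Here $\chi^f=x^f$ and $\Xi^f=\{x^f\ge0:\sum_{(u,v)\in A}c^f_{uv}x^f_{uv}\le b^f\}$; $\chi^{-f}$ denotes the other agents' decisions. A pure strategy Nash equilibrium is a profile in which each $\chi^f\in\Xi^f$ maximizes $\theta^f(\cdot,\chi^{-f})$ over $\Xi^f$. Regularized Gauss-Seidel algorithm with fixed parameter $\tau>0$: choose $\chi_0$ with $\chi_0^f\in\Xi^f$ for all $f$. For $k=0,1,2,\dots$ and, within each $k$, for $f=1,\dots,F$ in order: set $\chi^{-f}_{k,f}=(\chi^1_{k+1},\dots,\chi^{f-1}_{k+1},\chi^{f+1}_k,\dots,\chi^F_k)$,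 let $\chi^*_{k,f}$ be the optimal solution of $$\max_{\chi^f\in\Xi^f}\ \theta^f(\chi^f,\chi^{-f}_{k,f})-\tau\|\chi^f-\chi^f_k\|^2;$$ if $\theta^f(\chi^*_{k,f},\chi^{-f}_{k,f})>\theta^f(\chi^f_k,\chi^{-f}_{k,f})$ set $\chi^f_{k+1}=\chi^*_{k,f}$, otherwise set $\chi^f_{k+1}=\chi^f_k$. Then $\chi_{k+1}=(\chi^1_{k+1},\dots,\chi^F_{k+1})$. The sequence is regarded as infinite (no termination test). *)

theory Defs
  imports
    "HOL-Analysis.Analysis"
    "Graph_Theory.Pair_Digraph"
begin

section \<open>Games with finitely many ordered players\<close>

text \<open>
  Players are the elements of a finite linearly ordered type \<^typ>\<open>'f\<close>, the order being the one in
  which they move. A profile is a function on players, and \<open>x(f := y)\<close> is the profile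
  \<open>(y, x\<^sup>-\<^sup>f)\<close>. The payoff \<open>\<theta> f\<close> is a function of the whole profile.
\<close>

definition pure_nash_equilibrium ::
  "('f \<Rightarrow> 'a set) \<Rightarrow> ('f \<Rightarrow> ('f \<Rightarrow> 'a) \<Rightarrow> real) \<Rightarrow> ('f \<Rightarrow> 'a) \<Rightarrow> bool" where
  "pure_nash_equilibrium \<Xi> \<theta> x \<longleftrightarrow>
     (\<forall>f. is_arg_max (\<lambda>y. \<theta> f (x(f := y))) (\<lambda>y. y \<in> \<Xi> f) (x f))"

text \<open>
  The profile on the table when player \<open>f\<close> moves in round \<open>k\<close>. Its \<open>f\<close>-component is always
  overwritten below, so only the components \<open>-f\<close> matter.
\<close>

definition gs_profile ::
  "(nat \<Rightarrow> 'f::linorder \<Rightarrow> 'a) \<Rightarrow> nat \<Rightarrow> 'f \<Rightarrow> 'f \<Rightarrow> 'a" where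
  "gs_profile x k f = (\<lambda>g. if g < f then x (Suc k) g else x k g)"

definition regularized_gauss_seidel ::
  "('f::{finite,linorder} \<Rightarrow> 'a::real_normed_vector set) \<Rightarrow> ('f \<Rightarrow> ('f \<Rightarrow> 'a) \<Rightarrow> real) \<Rightarrow>
   real \<Rightarrow> (nat \<Rightarrow> 'f \<Rightarrow> 'a) \<Rightarrow> bool" where
  "regularized_gauss_seidel \<Xi> \<theta> \<tau> x \<longleftrightarrow>
     (\<forall>f. x 0 f \<in> \<Xi> f) \<and>
     (\<forall>k f. \<exists>y.
        is_arg_max (\<lambda>z. \<theta> f ((gs_profile x k f)(f := z)) - \<tau> * (norm (z - x k f))\<^sup>2)
          (\<lambda>z. z \<in> \<Xi> f) y \<and>
        x (Suc k) f =
          (if \<theta> f ((gs_profile x k f)(f := y)) > \<theta> f ((gs_profile x k f)(f := x k f))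
           then y else x k f))"

text \<open>
  For a finite player type, the topology on profiles is the product topology, which for Euclidean
  strategy spaces is the usual topology of the finite-dimensional profile space.
\<close>

definition cluster_point :: "(nat \<Rightarrow> 'a::topological_space) \<Rightarrow> 'a \<Rightarrow> bool" where
  "cluster_point x l \<longleftrightarrow> (\<exists>r. strict_mono r \<and> (x \<circ> r) \<longlonglongrightarrow> l)"

section \<open>Decentralized shortest path interdiction with a common source-target pair\<close>

definition st_paths :: "'v pair_pre_digraph \<Rightarrow> 'v \<Rightarrow> 'v \<Rightarrow> ('v \<times> 'v) list set" where
  "st_paths G s t = {p. pre_digraph.apath (with_proj G) s p t}"

text \<open>
  A vector indexed by the arc set is represented as a vector indexed by all pairs of vertices that
  vanishes outside the arc set; the Euclidean norms agree.
\<close>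

definition interdiction_set ::
  "'v::finite pair_pre_digraph \<Rightarrow> ('f \<Rightarrow> 'v \<times> 'v \<Rightarrow> real) \<Rightarrow> ('f \<Rightarrow> real) \<Rightarrow> 'f \<Rightarrow>
   (real ^ ('v \<times> 'v)) set" where
  "interdiction_set G c b f =
     {y. (\<forall>a. a \<notin> parcs G \<longrightarrow> y $ a = 0) \<and>
         (\<forall>a\<in>parcs G. 0 \<le> y $ a) \<and>
         (\<Sum>a\<in>parcs G. c f a * y $ a) \<le> b f}"

text \<open>
  Members of \<^const>\<open>st_paths\<close> repeat no vertex, hence no arc, so the length of \<open>p\<close> is a sum over
  \<open>set p\<close>. All players have the same payoff, so the argument \<open>f\<close> does not occur on the right.
\<close>

definition interdiction_payoff ::
  "'v::finite pair_pre_digraph \<Rightarrow> 'v \<Rightarrow> 'v \<Rightarrow> ('v \<times> 'v \<Rightarrow> real) \<Rightarrow> 'f::finite \<Rightarrow>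
   ('f \<Rightarrow> real ^ ('v \<times> 'v)) \<Rightarrow> real" where
  "interdiction_payoff G s t d0 f x =
     Min ((\<lambda>p. \<Sum>a\<in>set p. d0 a + (\<Sum>g\<in>UNIV. x g $ a)) ` st_paths G s t)"

end

theory Submission
  imports Defs
begin

text \<open>
  All players maximize the same payoff \<open>\<phi>\<close>, which is continuous and concave in each player's
  strategy. Comparing a regularized best response with staying put shows that a move of length
  \<open>\<delta>\<close> raises \<open>\<phi>\<close> by at least \<open>\<tau> \<delta>\<^sup>2\<close>, and that a rejected best response equals the current
  strategy. Hence \<open>\<phi>\<close> increases along the iterates, its limit is its value at the cluster point
  \<open>l\<close>, and the steps vanish along the subsequence. Passing to the limit in the optimality of each
  move, \<open>l f\<close> is a regularized best response against \<open>l\<close> with proximal centre \<open>l f\<close> itself.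
  Along a segment from \<open>l f\<close> the penalty is of second order, whereas a gain in the concave
  payoff would be of first order, so \<open>l f\<close> is a best response.
\<close>

section \<open>Limits of profiles, finite minima and proximal maximizers\<close>

lemma tendsto_fun_iff:
  fixes X :: "'b \<Rightarrow> 'i \<Rightarrow> 'a::topological_space"
  shows "(X \<longlongrightarrow> l) F \<longleftrightarrow> (\<forall>i. ((\<lambda>n. X n i) \<longlongrightarrow> l i) F)"
  using limitin_componentwise[of "\<lambda>_. euclidean :: 'a topology" UNIV X l F]
  by (simp add: euclidean_product_topology)

lemma continuous_on_Min:
  fixes f :: "'i \<Rightarrow> 'a::topological_space \<Rightarrow> 'b::linorder_topology"
  assumes "finite I" "I \<noteq> {}" "\<And>i. i \<in> I \<Longrightarrow> continuous_on S (f i)"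
  shows "continuous_on S (\<lambda>x. Min ((\<lambda>i. f i x) ` I))"
  using assms
proof (induction I rule: finite_ne_induct)
  case (insert i I)
  then have "continuous_on S (\<lambda>x. min (f i x) (Min ((\<lambda>i. f i x) ` I)))"
    by (intro continuous_on_min) auto
  with insert show ?case by simp
qed simp

text \<open>Each member of the family dominates the minimum at both ends of a segment, so its own
  concavity bounds it below by the same combination of the two minima.\<close>

lemma concave_on_Min:
  fixes f :: "'i \<Rightarrow> 'a::real_vector \<Rightarrow> real"
  assumes fin: "finite I" "I \<noteq> {}" and conc: "\<And>i. i \<in> I \<Longrightarrow> concave_on S (f i)"
  shows "concave_on S (\<lambda>x. Min ((\<lambda>i. f i x) ` I))"
  unfolding concave_on_iff
proof (intro conjI ballI allI impI)
  show "convex S"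
    using assms concave_on_imp_convex by blast
next
  fix x y and u v :: real
  assume S: "x \<in> S" "y \<in> S" and uv: "u \<ge> 0" "v \<ge> 0" "u + v = 1"
  let ?m = "\<lambda>z. Min ((\<lambda>i. f i z) ` I)"
  have "u * ?m x + v * ?m y \<le> f i (u *\<^sub>R x + v *\<^sub>R y)" if i: "i \<in> I" for i
  proof -
    have "u * ?m x + v * ?m y \<le> u * f i x + v * f i y"
      using fin i uv by (intro add_mono mult_left_mono) auto
    also have "\<dots> \<le> f i (u *\<^sub>R x + v *\<^sub>R y)"
      using conc[OF i] S uv by (auto simp: concave_on_iff)
    finally show ?thesis .
  qed
  then show "u * ?m x + v * ?m y \<le> ?m (u *\<^sub>R x + v *\<^sub>R y)"
    using fin by simp
qed

lemma concave_proximal_maximizer: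
  fixes h :: "'a::real_normed_vector \<Rightarrow> real"
  assumes conc: "concave_on S h" and a: "a \<in> S" and z: "z \<in> S" and "\<tau> > 0"
    and prox: "\<And>w. w \<in> S \<Longrightarrow> h w - \<tau> * (norm (w - a))\<^sup>2 \<le> h a"
  shows "h z \<le> h a"
proof (rule tendsto_upperbound[of "\<lambda>u. h z - u * (\<tau> * (norm (z - a))\<^sup>2)"])
  have "((\<lambda>u. h z - u * (\<tau> * (norm (z - a))\<^sup>2)) \<longlongrightarrow> h z - 0 * (\<tau> * (norm (z - a))\<^sup>2))
          (at_right 0)"
    by (intro tendsto_intros)
  then show "((\<lambda>u. h z - u * (\<tau> * (norm (z - a))\<^sup>2)) \<longlongrightarrow> h z) (at_right 0)"
    by simp
  \<comment> \<open>Testing \<open>prox\<close> at the point a fraction \<open>u\<close> of the way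
    to \<open>z\<close>, concavity gives a gain of at least \<open>u * (h z - h a)\<close> at a
    penalty proportional to the square of \<open>u\<close>; dividing by \<open>u\<close> leaves an
    error that vanishes with \<open>u\<close>.\<close>
  have "h z - u * (\<tau> * (norm (z - a))\<^sup>2) \<le> h a" if u: "0 < u" "u < 1" for u
  proof -
    let ?w = "(1 - u) *\<^sub>R a + u *\<^sub>R z"
    have "?w \<in> S"
      using concave_on_imp_convex[OF conc] a z u by (simp add: convex_alt)
    moreover have "?w - a = u *\<^sub>R (z - a)"
      by (simp add: algebra_simps)
    ultimately have "h ?w - \<tau> * (u * norm (z - a))\<^sup>2 \<le> h a"
      using prox[of ?w] u by simp
    moreover have "(1 - u) * h a + u * h z \<le> h ?w"
      using concave_onD[OF conc] a z u by simp
    ultimately have "u * (h z - u * (\<tau> * (norm (z - a))\<^sup>2)) \<le> u * h a"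
      by (simp add: algebra_simps power2_eq_square)
    with u show ?thesis by simp
  qed
  then show "\<forall>\<^sub>F u in at_right 0. h z - u * (\<tau> * (norm (z - a))\<^sup>2) \<le> h a"
    by (auto simp: eventually_at_right[of 0 1] intro!: exI[of _ 1])
qed simp

section \<open>Regularized best responses and ascent of the payoff\<close>

text \<open>
  If the acceptance test fails, the maximizer gains nothing in payoff, so its penalty vanishes and
  it is the current strategy. Thus the next iterate is the maximizer in either case.
\<close>

lemma regularized_gauss_seidel_is_arg_max:
  assumes gs: "regularized_gauss_seidel \<Xi> \<theta> \<tau> x" and "\<tau> > 0"
  shows regularized_gauss_seidel_mem: "x k f \<in> \<Xi> f"
    and "is_arg_max (\<lambda>z. \<theta> f ((gs_profile x k f)(f := z)) - \<tau> * (norm (z - x k f))\<^sup>2)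
           (\<lambda>z. z \<in> \<Xi> f) (x (Suc k) f)"
proof -
  let ?h = "\<lambda>k f z. \<theta> f ((gs_profile x k f)(f := z))"
  let ?opt = "\<lambda>k f. is_arg_max (\<lambda>z. ?h k f z - \<tau> * (norm (z - x k f))\<^sup>2) (\<lambda>z. z \<in> \<Xi> f)"
  have step: "\<exists>y. ?opt k f y \<and>
      x (Suc k) f = (if ?h k f y > ?h k f (x k f) then y else x k f)" for k f
    using gs by (simp add: regularized_gauss_seidel_def)
  have init: "x 0 f \<in> \<Xi> f" for f
    using gs by (simp add: regularized_gauss_seidel_def)
  have mem: "x k f \<in> \<Xi> f" for k f
  proof (induction k)
    case (Suc k)
    then show ?case using step[of f k] by (auto simp: is_arg_max_def)
  qed (rule init)
  then show "x k f \<in> \<Xi> f" .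
  obtain y where y: "?opt k f y"
      and x_Suc: "x (Suc k) f = (if ?h k f y > ?h k f (x k f) then y else x k f)"
    using step by blast
  have "x (Suc k) f = y"
  proof (cases "?h k f y > ?h k f (x k f)")
    case False
    have "?h k f (x k f) - \<tau> * (norm (x k f - x k f))\<^sup>2
        \<le> ?h k f y - \<tau> * (norm (y - x k f))\<^sup>2"
      using y mem[of k f] unfolding is_arg_max_linorder by blast
    with False have "\<tau> * (norm (y - x k f))\<^sup>2 \<le> 0"
      by simp
    then show ?thesis
      using \<open>\<tau> > 0\<close> x_Suc False by (simp add: mult_le_0_iff)
  qed (simp add: x_Suc)
  with y show "?opt k f (x (Suc k) f)"
    by simp
qed

text \<open>The gains of the single moves telescope over a round, so the induction follows the order
  of play.\<close>

lemma regularized_gauss_seidel_ascent: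
  fixes \<phi> :: "('f::{finite,linorder} \<Rightarrow> 'a::real_normed_vector) \<Rightarrow> real"
  assumes gs: "regularized_gauss_seidel \<Xi> (\<lambda>_. \<phi>) \<tau> x" and "\<tau> > 0"
  shows "\<phi> (x k) + \<tau> * (\<Sum>f\<in>UNIV. (norm (x (Suc k) f - x k f))\<^sup>2) \<le> \<phi> (x (Suc k))"
proof -
  \<comment> \<open>For an initial segment \<open>A\<close> of the players, which
    \<open>?down A\<close> demands, \<open>?mix A\<close> is the profile once exactly the players in
    \<open>A\<close> have moved in round \<open>k\<close>.\<close>
  let ?mix = "\<lambda>A g. if g \<in> A then x (Suc k) g else x k g"
  let ?down = "\<lambda>A. \<forall>f\<in>A. \<forall>g\<le>f. g \<in> A"
  have "?down A \<longrightarrow> \<phi> (x k) + \<tau> * (\<Sum>f\<in>A. (norm (x (Suc k) f - x k f))\<^sup>2) \<le> \<phi> (?mix A)"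
    if "finite A" for A :: "'f set"
    using that
  proof (induction A rule: finite_linorder_max_induct)
    case (insert f A)
    show ?case
    proof
      assume down: "?down (insert f A)"
      \<comment> \<open>The inserted player exceeds all of \<open>A\<close>, and downward closure
        leaves no gap below it.\<close>
      with insert.hyps have A: "A = {..<f}"
        by (auto simp: less_le)
      then have "?down A"
        by auto
      with insert.IH have IH:
        "\<phi> (x k) + \<tau> * (\<Sum>f\<in>A. (norm (x (Suc k) f - x k f))\<^sup>2) \<le> \<phi> (?mix A)"
        by blast
      have before: "(gs_profile x k f)(f := x k f) = ?mix A"
        and after: "(gs_profile x k f)(f := x (Suc k) f) = ?mix (insert f A)"
        by (auto simp: gs_profile_def A)
      \<comment> \<open>The new strategy competes with staying put, whose penalty is zero.\<close>
      have "\<phi> (?mix A) \<le> \<phi> (?mix (insert f A)) - \<tau> * (norm (x (Suc k) f - x k f))\<^sup>2"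
        using regularized_gauss_seidel_is_arg_max[OF gs \<open>\<tau> > 0\<close>, of k f]
          regularized_gauss_seidel_mem[OF gs \<open>\<tau> > 0\<close>, of k f]
        unfolding is_arg_max_linorder before[symmetric] after[symmetric] by fastforce
      moreover have "f \<notin> A"
        by (simp add: A)
      ultimately show "\<phi> (x k) + \<tau> * (\<Sum>f\<in>insert f A. (norm (x (Suc k) f - x k f))\<^sup>2)
          \<le> \<phi> (?mix (insert f A))"
        using IH \<open>finite A\<close> by (simp add: distrib_left)
    qed
  qed simp
  from this[OF finite, of UNIV] show ?thesis by simp
qed

theorem regularized_gauss_seidel_cluster_point:
  fixes \<phi> :: "('f::{finite,linorder} \<Rightarrow> 'a::real_normed_vector) \<Rightarrow> real"
  assumes gs: "regularized_gauss_seidel \<Xi> (\<lambda>_. \<phi>) \<tau> x" and "\<tau> > 0"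
    and cont: "continuous_on UNIV \<phi>"
    and conc: "\<And>f z. concave_on (\<Xi> f) (\<lambda>y. \<phi> (z(f := y)))"
    and cl: "\<And>f. closed (\<Xi> f)"
    and "cluster_point x l"
  shows "pure_nash_equilibrium \<Xi> (\<lambda>_. \<phi>) l"
proof -
  obtain r where r: "strict_mono r" and lim: "(\<lambda>n. x (r n)) \<longlonglongrightarrow> l"
    using \<open>cluster_point x l\<close> by (auto simp: cluster_point_def o_def)
  have \<phi>_lim: "(\<lambda>n. \<phi> (X n)) \<longlonglongrightarrow> \<phi> L" if "X \<longlonglongrightarrow> L" for X L
    using continuous_on_tendsto_compose[OF cont that] by simp
  note ascent = regularized_gauss_seidel_ascent[OF gs \<open>\<tau> > 0\<close>]
  have "\<phi> (x k) \<le> \<phi> (x (Suc k))" for k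
    using ascent[of k] \<open>\<tau> > 0\<close>
    by (meson add_increasing2 sum_nonneg zero_le_power2 mult_nonneg_nonneg less_imp_le
        order_trans order_refl)
  then have inc: "incseq (\<lambda>k. \<phi> (x k))"
    by (rule incseq_SucI)
  \<comment> \<open>As k \<le> \<open>r k\<close>, monotonicity carries the bound from the
    subsequence to all iterates, including the successors \<open>Suc (r n)\<close>.\<close>
  have ub: "\<phi> (x k) \<le> \<phi> l" for k
  proof -
    have "\<phi> (x k) \<le> \<phi> (x (r k))"
      using inc seq_suble[OF r] by (simp add: incseq_def)
    also have "\<dots> \<le> \<phi> l"
      using inc r by (intro incseq_le[OF _ \<phi>_lim[OF lim]])
        (auto simp: incseq_def strict_mono_less_eq)
    finally show ?thesis .
  qed
  \<comment> \<open>The step out of round \<open>r n\<close> is paid for by the remaining gap to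
    \<open>\<phi> l\<close>, which closes, so the successors share the limit.\<close>
  have lim_Suc: "(\<lambda>n. x (Suc (r n)) f) \<longlonglongrightarrow> l f" for f
  proof -
    have bound: "(norm (x (Suc (r n)) f - x (r n) f))\<^sup>2 \<le> (\<phi> l - \<phi> (x (r n))) / \<tau>" for n
    proof -
      have "\<tau> * (norm (x (Suc (r n)) f - x (r n) f))\<^sup>2
          \<le> \<tau> * (\<Sum>f\<in>UNIV. (norm (x (Suc (r n)) f - x (r n) f))\<^sup>2)"
        using \<open>\<tau> > 0\<close> by (intro mult_left_mono member_le_sum) auto
      also have "\<dots> \<le> \<phi> l - \<phi> (x (r n))"
        using ascent[of "r n"] ub[of "Suc (r n)"] by linarith
      finally show ?thesis
        using \<open>\<tau> > 0\<close> by (simp add: field_simps)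
    qed
    have "(\<lambda>n. (\<phi> l - \<phi> (x (r n))) / \<tau>) \<longlonglongrightarrow> (\<phi> l - \<phi> l) / \<tau>"
      using \<open>\<tau> > 0\<close> by (intro tendsto_intros \<phi>_lim lim) auto
    then have "(\<lambda>n. (\<phi> l - \<phi> (x (r n))) / \<tau>) \<longlonglongrightarrow> 0"
      by simp
    then have "(\<lambda>n. (norm (x (Suc (r n)) f - x (r n) f))\<^sup>2) \<longlonglongrightarrow> 0"
      by (rule tendsto_sandwich[rotated 3]) (use bound in auto)
    then have "(\<lambda>n. sqrt ((norm (x (Suc (r n)) f - x (r n) f))\<^sup>2)) \<longlonglongrightarrow> sqrt 0"
      by (rule tendsto_real_sqrt)
    then have "(\<lambda>n. x (Suc (r n)) f - x (r n) f) \<longlonglongrightarrow> 0"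
      by (simp add: tendsto_norm_zero_iff)
    moreover have "(\<lambda>n. x (r n) f) \<longlonglongrightarrow> l f"
      using lim by (simp add: tendsto_fun_iff)
    ultimately show ?thesis
      using tendsto_add by fastforce
  qed
  \<comment> \<open>A profile in mid-round mixes components of rounds \<open>r n\<close> and
    \<open>Suc (r n)\<close>, all with limits in \<open>l\<close>. The slot \<open>w\<close> serves
    both a fixed competitor and the actual move.\<close>
  have gs_lim: "(\<lambda>n. (gs_profile x (r n) f)(f := w n)) \<longlonglongrightarrow> l(f := z)" if "w \<longlonglongrightarrow> z" for f w z
    unfolding tendsto_fun_iff
  proof
    show "(\<lambda>n. ((gs_profile x (r n) f)(f := w n)) g) \<longlonglongrightarrow> (l(f := z)) g" for g
      using that lim_Suc[of g] lim
      by (cases "g < f") (auto simp: tendsto_fun_iff gs_profile_def)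
  qed
  have mem: "l f \<in> \<Xi> f" for f
    using closed_sequentially[OF cl, of "\<lambda>n. x (Suc (r n)) f"] lim_Suc
      regularized_gauss_seidel_mem[OF gs \<open>\<tau> > 0\<close>] by blast
  \<comment> \<open>The form \<open>l(f := l f)\<close> matches \<open>h a\<close> in
    \<open>concave_proximal_maximizer\<close> for \<open>h y = \<phi> (l(f := y))\<close>.\<close>
  have prox: "\<phi> (l(f := z)) - \<tau> * (norm (z - l f))\<^sup>2 \<le> \<phi> (l(f := l f))" if z: "z \<in> \<Xi> f" for f z
  proof (rule LIMSEQ_le)
    show "(\<lambda>n. \<phi> ((gs_profile x (r n) f)(f := z)) - \<tau> * (norm (z - x (r n) f))\<^sup>2)
        \<longlonglongrightarrow> \<phi> (l(f := z)) - \<tau> * (norm (z - l f))\<^sup>2"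
      using lim by (intro tendsto_intros \<phi>_lim gs_lim) (simp add: tendsto_fun_iff)
    show "(\<lambda>n. \<phi> ((gs_profile x (r n) f)(f := x (Suc (r n)) f))) \<longlonglongrightarrow> \<phi> (l(f := l f))"
      by (intro \<phi>_lim gs_lim lim_Suc)
    have "\<phi> ((gs_profile x (r n) f)(f := z)) - \<tau> * (norm (z - x (r n) f))\<^sup>2
        \<le> \<phi> ((gs_profile x (r n) f)(f := x (Suc (r n)) f))
            - \<tau> * (norm (x (Suc (r n)) f - x (r n) f))\<^sup>2" for n
      using regularized_gauss_seidel_is_arg_max[OF gs \<open>\<tau> > 0\<close>, of "r n" f] z
      by (simp add: is_arg_max_linorder)
    moreover have "\<tau> * (norm (x (Suc (r n)) f - x (r n) f))\<^sup>2 \<ge> 0" for n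
      using \<open>\<tau> > 0\<close> by simp
    ultimately show "\<exists>N. \<forall>n\<ge>N. \<phi> ((gs_profile x (r n) f)(f := z)) - \<tau> * (norm (z - x (r n) f))\<^sup>2
        \<le> \<phi> ((gs_profile x (r n) f)(f := x (Suc (r n)) f))"
      by (smt (verit))
  qed
  show ?thesis
    unfolding pure_nash_equilibrium_def is_arg_max_linorder
    using concave_proximal_maximizer[OF conc mem _ \<open>\<tau> > 0\<close> prox] mem by blast
qed

section \<open>The interdiction game as an instance\<close>

lemma finite_st_paths:
  assumes "pair_fin_digraph G"
  shows "finite (st_paths G s t)"
proof -
  interpret pair_fin_digraph G by (rule assms)
  show ?thesis
    unfolding st_paths_def by (rule apaths_finite)
qed

lemma closed_interdiction_set: "closed (interdiction_set G c b f)"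
  \<comment> \<open>The arc conditions become implications whose premises do not involve the vector
    and whose conclusions are closed.\<close>
  unfolding interdiction_set_def Ball_def
  by (intro closed_Collect_conj closed_Collect_all closed_Collect_imp closed_Collect_eq
      closed_Collect_le continuous_intros) auto

lemma convex_interdiction_set: "convex (interdiction_set G c b f)"
proof (rule convexI)
  fix y z and u v :: real
  assume y: "y \<in> interdiction_set G c b f" and z: "z \<in> interdiction_set G c b f"
    and uv: "0 \<le> u" "0 \<le> v" "u + v = 1"
  let ?cost = "\<lambda>y. \<Sum>a\<in>parcs G. c f a * y $ a"
  have "?cost (u *\<^sub>R y + v *\<^sub>R z) = u * ?cost y + v * ?cost z"
    by (simp add: sum.distrib sum_distrib_left algebra_simps)
  also have "\<dots> \<le> b f"
    using y z uv by (intro convex_bound_le) (auto simp: interdiction_set_def)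
  finally show "u *\<^sub>R y + v *\<^sub>R z \<in> interdiction_set G c b f"
    using y z uv by (auto simp: interdiction_set_def)
qed

lemma continuous_on_interdiction_payoff:
  assumes "finite (st_paths G s t)" "st_paths G s t \<noteq> {}"
  shows "continuous_on UNIV (interdiction_payoff G s t d0 f)"
  unfolding interdiction_payoff_def using assms
  by (intro continuous_on_Min continuous_intros) auto

lemma concave_on_interdiction_payoff:
  fixes z :: "'f::finite \<Rightarrow> real ^ ('v::finite \<times> 'v)"
  assumes "finite (st_paths G s t)" "st_paths G s t \<noteq> {}" and S: "convex S"
  shows "concave_on S (\<lambda>y. interdiction_payoff G s t d0 h (z(f := y)))"
  unfolding interdiction_payoff_def
proof (rule concave_on_Min[OF assms(1,2)])
  fix p
  have eq: "(\<Sum>g\<in>UNIV. (z(f := y)) g $ a) = y $ a + (\<Sum>g\<in>UNIV - {f}. z g $ a)" for y a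
    by (simp add: sum.remove[of UNIV f])
  show "concave_on S (\<lambda>y. \<Sum>a\<in>set p. d0 a + (\<Sum>g\<in>UNIV. (z(f := y)) g $ a))"
    unfolding concave_on_iff eq
  \<comment> \<open>A path length is affine in \<open>y\<close>, so the concavity inequality holds
    with equality, which \<open>eq_refl\<close> exploits.\<close>
  proof (intro conjI S ballI allI impI eq_refl)
    fix y w and u v :: real
    assume uv: "u + v = 1"
    define C where "C a = d0 a + (\<Sum>g\<in>UNIV - {f}. z g $ a)" for a
    have v: "v = 1 - u" using uv by simp
    show "u * (\<Sum>a\<in>set p. d0 a + (y $ a + (\<Sum>g\<in>UNIV - {f}. z g $ a)))
        + v * (\<Sum>a\<in>set p. d0 a + (w $ a + (\<Sum>g\<in>UNIV - {f}. z g $ a)))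
      = (\<Sum>a\<in>set p. d0 a + ((u *\<^sub>R y + v *\<^sub>R w) $ a + (\<Sum>g\<in>UNIV - {f}. z g $ a)))"
      unfolding sum_distrib_left v sum.distrib[symmetric]
      by (intro sum.cong refl) (simp add: algebra_simps)
  qed
qed

theorem proposition7:
  fixes G :: "'v::finite pair_pre_digraph"
    and s t :: 'v
    and d0 :: "'v \<times> 'v \<Rightarrow> real"
    and c :: "'f::{finite,linorder} \<Rightarrow> 'v \<times> 'v \<Rightarrow> real"
    and b :: "'f \<Rightarrow> real"
    and \<tau> :: real
    and x :: "nat \<Rightarrow> 'f \<Rightarrow> real ^ ('v \<times> 'v)"
    and xbar :: "'f \<Rightarrow> real ^ ('v \<times> 'v)"
  assumes "pair_fin_digraph G"
    and "st_paths G s t \<noteq> {}"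
    and "\<And>a. a \<in> parcs G \<Longrightarrow> d0 a > 0"
    and "\<And>f a. a \<in> parcs G \<Longrightarrow> c f a > 0"
    and "\<And>f. b f > 0"
    and "\<tau> > 0"
    and "regularized_gauss_seidel (interdiction_set G c b) (interdiction_payoff G s t d0) \<tau> x"
    and "cluster_point x xbar"
  shows "pure_nash_equilibrium (interdiction_set G c b) (interdiction_payoff G s t d0) xbar"
proof -
  \<comment> \<open>The payoff is the same for every player, so an arbitrary one may stand in for
    all.\<close>
  define \<phi> where "\<phi> = interdiction_payoff G s t d0 (undefined :: 'f)"
  have eq: "interdiction_payoff G s t d0 = (\<lambda>_ :: 'f. \<phi>)"
    by (simp add: \<phi>_def interdiction_payoff_def fun_eq_iff)
  note paths = finite_st_paths[OF assms(1)] assms(2)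
  show ?thesis
    unfolding eq
  proof (rule regularized_gauss_seidel_cluster_point)
    show "regularized_gauss_seidel (interdiction_set G c b) (\<lambda>_. \<phi>) \<tau> x"
      using assms(7) unfolding eq .
    show "continuous_on UNIV \<phi>"
      unfolding \<phi>_def by (rule continuous_on_interdiction_payoff[OF paths])
    show "concave_on (interdiction_set G c b f) (\<lambda>y. \<phi> (z(f := y)))" for f z
      unfolding \<phi>_def
      by (rule concave_on_interdiction_payoff[OF paths convex_interdiction_set])
  qed (rule assms closed_interdiction_set)+
qed

end
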